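(* Let $R$ be an integral domain and let $A,B : X_2^3\to R^\times$ be maps. Define the ring homomorphism $f_{A,B}:\mathbb{Z}[x_1^{\pm1},\dots,x_5^{\pm1}]\to R$ by $f_{A,B}(1)=1_R$, $f_{A,B}(x_1)=A_{0,0,0}$, $f_{A,B}(x_2)=A_{0,0,1}$, $f_{A,B}(x_3)=A_{0,1,0}$, $f_{A,B}(x_4)=A_{1,0,1}$, $f_{A,B}(x_5)=B_{0,0,0}$. Then $(A,B)$ is a tribracket bracket with respect to $X_2$ and $R$ if and only if there exists $i\in\{1,2,3,4,5\}$ such that $(f_{A,B}\circ A^{(i)},\, f_{A,B}\circ B^{(i)})=(A,B)$.
   Context: $X_2=\mathbb{Z}/2\mathbb{Z}$ with ternary operation $[a,b,c]=a+b-c$. For a commutative ring $R$ with unit group $R^\times$, a pair of maps $A,B:X_2^3\to R^\times$, written $A(a,b,c)=A_{a,b,c}$, $B(a,b,c)=B_{a,b,c}$, is a tribracket bracket with respect to $X_2$ and $R$ if: (1) there is $\delta\in R$ with $\delta=-A_{a,b,c}B_{a,b,c}^{-1}-A_{a,b,c}^{-1}B_{a,b,c}$ for all $a,b,c$; (2) there is $w\in R$ with $w=-A_{a,b,b}^2B_{a,b,b}^{-1}$ for all $a,b$; (3) for all $a,b,c,d\in X_2$, writing $P=(a,b,c)$, $Q=(c,[a,b,c],[a,c,d])$, $S=(a,c,d)$, $P'=(b,[a,b,c],[a,b,d])$, $Q'=(a,b,d)$, $S'=(d,[a,b,d],[a,c,d])$: (a) $A_PA_QA_S=A_{P'}A_{Q'}A_{S'}$;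 (b) $A_PB_QB_S=B_{P'}B_{Q'}A_{S'}$; (c) $B_PB_QA_S=A_{P'}B_{Q'}B_{S'}$; (d) $A_PB_QA_S=A_{P'}A_{Q'}B_{S'}+B_{P'}A_{Q'}A_{S'}+\delta B_{P'}A_{Q'}B_{S'}+B_{P'}B_{Q'}B_{S'}$; (e) $A_PA_QB_S+B_PA_QA_S+\delta B_PA_QB_S+B_PB_QB_S=A_{P'}B_{Q'}A_{S'}$. The maps $A^{(i)},B^{(i)}:X_2^3\to\mathbb{Z}[x_1^{\pm1},\dots,x_5^{\pm1}]$, $i=1,\dots,5$, are as follows. For every $i$: $A^{(i)}_{0,0,0}=A^{(i)}_{1,1,1}=x_1$, $A^{(i)}_{0,0,1}=x_2$, $A^{(i)}_{0,1,0}=x_3$, $A^{(i)}_{1,0,1}=x_4$, $A^{(i)}_{1,1,0}=x_2x_3x_4^{-1}$, $B^{(i)}_{0,0,0}=B^{(i)}_{1,1,1}=x_5$. For $i=1,3,5$: $A^{(i)}_{0,1,1}=A^{(i)}_{1,0,0}=x_1$ and $B^{(i)}_{0,1,1}=B^{(i)}_{1,0,0}=x_5$. For $i=2,4$: $A^{(i)}_{0,1,1}=A^{(i)}_{1,0,0}=x_1^3x_5^{-2}$ and $B^{(i)}_{0,1,1}=B^{(i)}_{1,0,0}=x_1^4x_5^{-3}$. For $i=1,2$: $B^{(i)}_{0,0,1}=x_1^{-1}x_2x_5$, $B^{(i)}_{0,1,0}=x_1x_3x_5^{-1}$, $B^{(i)}_{1,0,1}=x_1x_4x_5^{-1}$,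 $B^{(i)}_{1,1,0}=x_1^{-1}x_2x_3x_4^{-1}x_5$. For $i=3,4$: $B^{(i)}_{0,0,1}=x_1x_2x_5^{-1}$, $B^{(i)}_{0,1,0}=x_1^{-1}x_3x_5$, $B^{(i)}_{1,0,1}=x_1^{-1}x_4x_5$, $B^{(i)}_{1,1,0}=x_1x_2x_3x_4^{-1}x_5^{-1}$. For $i=5$: $B^{(5)}_{0,0,1}=x_1^{-1}x_2x_5$, $B^{(5)}_{0,1,0}=x_1^{-1}x_3x_5$, $B^{(5)}_{1,0,1}=x_1^{-1}x_4x_5$, $B^{(5)}_{1,1,0}=x_1^{-1}x_2x_3x_4^{-1}x_5$. *)

theory Defs
  imports "HOL-Library.Z2" "HOL-Library.Poly_Mapping"
begin

section \<open>Tribracket brackets with respect to \<open>X\<^sub>2\<close>\<close>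

text \<open>
  The set \<open>X\<^sub>2 = \<int>/2\<int>\<close> is the type \<^typ>\<open>bit\<close>. In a commutative ring, the
  units are the elements dividing \<open>1\<close>.
\<close>

definition tb :: "bit \<Rightarrow> bit \<Rightarrow> bit \<Rightarrow> bit"
  where "tb a b c = a + b - c"

text \<open>
  The operation \<^const>\<open>inverse\<close> and integer powers of the library need a field-like type class, so
  the inverse of a unit of a commutative ring is introduced here. Both operations
  are meaningful for units only.
\<close>

definition unit_inv :: "'r::comm_ring_1 \<Rightarrow> 'r"
  where "unit_inv u = (THE v. u * v = 1)"

definition unit_powi :: "'r::comm_ring_1 \<Rightarrow> int \<Rightarrow> 'r"
  where "unit_powi u n = (if n \<ge> 0 then u ^ nat n else unit_inv u ^ nat (- n))"

definition tribracket_bracket ::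
    "(bit \<times> bit \<times> bit \<Rightarrow> 'r::comm_ring_1) \<Rightarrow> (bit \<times> bit \<times> bit \<Rightarrow> 'r) \<Rightarrow> bool"
  where "tribracket_bracket A B \<longleftrightarrow>
    (\<forall>p. A p dvd 1 \<and> B p dvd 1) \<and>
    (\<exists>\<delta> w.
      (\<forall>a b c. \<delta> = - A (a, b, c) * unit_inv (B (a, b, c)) - unit_inv (A (a, b, c)) * B (a, b, c)) \<and>
      (\<forall>a b. w = - ((A (a, b, b))\<^sup>2 * unit_inv (B (a, b, b)))) \<and>
      (\<forall>a b c d.
        let P = (a, b, c); Q = (c, tb a b c, tb a c d); S = (a, c, d);
            P' = (b, tb a b c, tb a b d); Q' = (a, b, d); S' = (d, tb a b d, tb a c d)
        in
          A P * A Q * A S = A P' * A Q' * A S' \<and>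
          A P * B Q * B S = B P' * B Q' * A S' \<and>
          B P * B Q * A S = A P' * B Q' * B S' \<and>
          A P * B Q * A S =
            A P' * A Q' * B S' + B P' * A Q' * A S' + \<delta> * B P' * A Q' * B S' + B P' * B Q' * B S' \<and>
          A P * A Q * B S + B P * A Q * A S + \<delta> * B P * A Q * B S + B P * B Q * B S =
            A P' * B Q' * A S'))"

section \<open>The Laurent polynomial ring in five variables\<close>

datatype lvar = X1 | X2 | X3 | X4 | X5

lemma UNIV_lvar: "UNIV = {X1, X2, X3, X4, X5}"
  by (auto intro: lvar.exhaust)

instance lvar :: finite
  by standard (simp add: UNIV_lvar)

text \<open>
  A Laurent monomial is its exponent vector in \<open>\<int>\<^sup>5\<close>; the Laurent polynomial
  ring is the group ring of \<open>\<int>\<^sup>5\<close> over \<open>\<int>\<close>, with the convolution product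
  of the theory of polynomial mappings.
\<close>

type_synonym laurent = "(lvar \<Rightarrow>\<^sub>0 int) \<Rightarrow>\<^sub>0 int"

definition lpow :: "lvar \<Rightarrow> int \<Rightarrow> laurent"  \<comment> \<open>the \<open>n\<close>-th power of the variable \<open>i\<close>\<close>
  where "lpow i n = Poly_Mapping.single (Poly_Mapping.single i n) 1"

definition laurent_eval :: "(lvar \<Rightarrow> 'r::comm_ring_1) \<Rightarrow> laurent \<Rightarrow> 'r"
  where "laurent_eval u p =
    (\<Sum>m\<in>Poly_Mapping.keys p. of_int (Poly_Mapping.lookup p m) *
       (\<Prod>i\<in>UNIV. unit_powi (u i) (Poly_Mapping.lookup m i)))"

text \<open>The ring homomorphism \<open>f\<^bsub>A,B\<^esub>\<close>.\<close>

definition laurent_hom ::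
    "(bit \<times> bit \<times> bit \<Rightarrow> 'r::comm_ring_1) \<Rightarrow> (bit \<times> bit \<times> bit \<Rightarrow> 'r) \<Rightarrow> laurent \<Rightarrow> 'r"
  where "laurent_hom A B = laurent_eval (\<lambda>i. case i of
      X1 \<Rightarrow> A (0, 0, 0) | X2 \<Rightarrow> A (0, 0, 1) | X3 \<Rightarrow> A (0, 1, 0) | X4 \<Rightarrow> A (1, 0, 1)
    | X5 \<Rightarrow> B (0, 0, 0))"

section \<open>The five families\<close>

text \<open>The indices that matter are \<open>1, \<dots>, 5\<close>; the values at other indices are irrelevant.\<close>

definition A_fam :: "nat \<Rightarrow> bit \<times> bit \<times> bit \<Rightarrow> laurent"
  where "A_fam i p =
    (if p = (0, 0, 0) \<or> p = (1, 1, 1) then lpow X1 1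
     else if p = (0, 0, 1) then lpow X2 1
     else if p = (0, 1, 0) then lpow X3 1
     else if p = (1, 0, 1) then lpow X4 1
     else if p = (1, 1, 0) then lpow X2 1 * lpow X3 1 * lpow X4 (-1)
     else \<comment> \<open>\<open>p = (0, 1, 1)\<close> or \<open>p = (1, 0, 0)\<close>\<close>
       (if i \<in> {1, 3, 5} then lpow X1 1 else lpow X1 3 * lpow X5 (-2)))"

definition B_fam :: "nat \<Rightarrow> bit \<times> bit \<times> bit \<Rightarrow> laurent"
  where "B_fam i p =
    (if p = (0, 0, 0) \<or> p = (1, 1, 1) then lpow X5 1
     else if p = (0, 1, 1) \<or> p = (1, 0, 0) then
       (if i \<in> {1, 3, 5} then lpow X5 1 else lpow X1 4 * lpow X5 (-3))
     else if p = (0, 0, 1) then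
       (if i \<in> {1, 2, 5} then lpow X1 (-1) * lpow X2 1 * lpow X5 1
        else lpow X1 1 * lpow X2 1 * lpow X5 (-1))
     else if p = (0, 1, 0) then
       (if i \<in> {1, 2} then lpow X1 1 * lpow X3 1 * lpow X5 (-1)
        else lpow X1 (-1) * lpow X3 1 * lpow X5 1)
     else if p = (1, 0, 1) then
       (if i \<in> {1, 2} then lpow X1 1 * lpow X4 1 * lpow X5 (-1)
        else lpow X1 (-1) * lpow X4 1 * lpow X5 1)
     else \<comment> \<open>\<open>p = (1, 1, 0)\<close>\<close>
       (if i \<in> {1, 2, 5} then lpow X1 (-1) * lpow X2 1 * lpow X3 1 * lpow X4 (-1) * lpow X5 1
        else lpow X1 1 * lpow X2 1 * lpow X3 1 * lpow X4 (-1) * lpow X5 (-1)))"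

section \<open>Sanity checks\<close>

text \<open>
  \<^const>\<open>unit_inv\<close> is the inverse on units, \<^const>\<open>lpow\<close> consists of the powers of units, and
  \<^const>\<open>laurent_eval\<close> at units is the unique unital ring homomorphism with the
  prescribed values on the variables.
\<close>

lemma unit_inv_eqI:
  fixes u v :: "'r::comm_ring_1"
  assumes "u * v = 1"
  shows "unit_inv u = v"
  unfolding unit_inv_def
proof (rule the_equality)
  fix v' assume "u * v' = 1"
  then show "v' = v" using assms by (metis mult.assoc mult.commute mult.right_neutral)
qed (rule assms)

lemma unit_inv_right:
  fixes u :: "'r::comm_ring_1"
  assumes "u dvd 1"
  shows "u * unit_inv u = 1"
  using assms unit_inv_eqI unfolding dvd_def by metis

lemma unit_powi_0 [simp]: "unit_powi u 0 = 1"
  and unit_powi_1 [simp]: "unit_powi u 1 = u"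
  by (simp_all add: unit_powi_def)

lemma unit_powi_Suc:
  fixes u :: "'r::comm_ring_1"
  assumes "u dvd 1"
  shows "unit_powi u (n + 1) = u * unit_powi u n"
proof (cases "n \<ge> 0")
  case True
  then show ?thesis by (simp add: unit_powi_def nat_add_distrib)
next
  case False
  then have "nat (- n) = Suc (nat (- (n + 1)))" by simp
  moreover have "unit_powi u (n + 1) = unit_inv u ^ nat (- (n + 1))"
  proof (cases "n = -1")
    case False
    with \<open>\<not> n \<ge> 0\<close> show ?thesis by (simp add: unit_powi_def)
  qed simp
  ultimately show ?thesis using False unit_inv_right[OF assms]
    by (simp add: unit_powi_def mult.assoc[symmetric])
qed

lemma unit_powi_add:
  fixes u :: "'r::comm_ring_1"
  assumes "u dvd 1"
  shows "unit_powi u (m + n) = unit_powi u m * unit_powi u n"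
proof (induction m rule: int_induct[where k = 0])
  case (step1 i)
  show ?case
    using unit_powi_Suc[OF assms, of "i + n"] unit_powi_Suc[OF assms, of i] step1
    by (simp add: algebra_simps)
next
  case (step2 i)
  have "u * unit_powi u (i - 1 + n) = u * (unit_powi u (i - 1) * unit_powi u n)"
    using unit_powi_Suc[OF assms, of "i - 1 + n"] unit_powi_Suc[OF assms, of "i - 1"] step2
    by (simp add: algebra_simps)
  then have "unit_inv u * u * unit_powi u (i - 1 + n)
      = unit_inv u * u * (unit_powi u (i - 1) * unit_powi u n)"
    by (simp add: mult.assoc)
  then show ?case
    using unit_inv_right[OF assms] by (simp add: mult.commute[of "unit_inv u"])
qed simp

lemma lpow_0 [simp]: "lpow i 0 = 1"
  by (simp add: lpow_def)

lemma lpow_add: "lpow i (m + n) = lpow i m * lpow i n"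
  by (simp add: lpow_def mult_single single_add)

lemma lpow_unit: "lpow i 1 dvd 1"
  by (metis add.right_inverse dvd_triv_left lpow_0 lpow_add)

lemma unit_powi_unique:
  fixes g :: "int \<Rightarrow> 'r::comm_ring_1"
  assumes 0: "g 0 = 1" and add: "\<And>m n. g (m + n) = g m * g n"
  shows "g n = unit_powi (g 1) n"
proof -
  have inv: "g 1 * g (-1) = 1"
    using 0 add[of 1 "-1"] by simp
  then have unit: "g 1 dvd 1"
    by (metis dvd_triv_left)
  show ?thesis
  proof (induction n rule: int_induct[where k = 0])
    case (step1 j)
    then show ?case
      using unit_powi_Suc[OF unit, of j] add[of 1 j] by (simp add: add.commute)
  next
    case (step2 j)
    have "g 1 * g (j - 1) = g 1 * unit_powi (g 1) (j - 1)"
      using unit_powi_Suc[OF unit, of "j - 1"] add[of 1 "j - 1"] step2 by simp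
    then have "g (-1) * g 1 * g (j - 1) = g (-1) * g 1 * unit_powi (g 1) (j - 1)"
      by (simp add: mult.assoc)
    then show ?case using inv by (simp add: mult.commute[of "g (-1)"])
  qed (simp add: 0)
qed

lemma lpow_eq_unit_powi: "lpow i n = unit_powi (lpow i 1) n"
  by (rule unit_powi_unique) (simp_all add: lpow_add)

lemma laurent_eval_superset:
  assumes "finite S" "Poly_Mapping.keys p \<subseteq> S"
  shows "laurent_eval u p = (\<Sum>m\<in>S. of_int (Poly_Mapping.lookup p m) *
       (\<Prod>i\<in>UNIV. unit_powi (u i) (Poly_Mapping.lookup m i)))"
  unfolding laurent_eval_def
  by (rule sum.mono_neutral_left) (use assms in \<open>auto simp: in_keys_iff\<close>)

lemma laurent_eval_add: "laurent_eval u (p + q) = laurent_eval u p + laurent_eval u q"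
proof -
  let ?S = "Poly_Mapping.keys p \<union> Poly_Mapping.keys q"
  have "laurent_eval u r = (\<Sum>m\<in>?S. of_int (Poly_Mapping.lookup r m) *
       (\<Prod>i\<in>UNIV. unit_powi (u i) (Poly_Mapping.lookup m i)))" if "r \<in> {p, q, p + q}" for r
    by (rule laurent_eval_superset) (use that Poly_Mapping.keys_add[of p q] in auto)
  then show ?thesis by (simp add: lookup_add algebra_simps sum.distrib)
qed

lemma laurent_eval_0 [simp]: "laurent_eval u 0 = 0"
  by (simp add: laurent_eval_def)

lemma laurent_eval_single:
  "laurent_eval u (Poly_Mapping.single m c) =
    of_int c * (\<Prod>i\<in>UNIV. unit_powi (u i) (Poly_Mapping.lookup m i))"
  by (subst laurent_eval_superset[where S = "{m}"]) auto

lemma laurent_eval_1: "laurent_eval u 1 = 1"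
  using laurent_eval_single[of u 0 1] by simp

lemma laurent_induct [case_names zero add]:
  fixes p :: laurent
  assumes "P 0" "\<And>m c p. P p \<Longrightarrow> P (Poly_Mapping.single m c + p)"
  shows "P p"
proof (induction p rule: update_induct)
  case const
  then show ?case using assms(1) by simp
next
  case (update p m c)
  then have "Poly_Mapping.update m c p = Poly_Mapping.single m c + p"
    by (intro poly_mapping_eqI) (auto simp: lookup_update lookup_add lookup_single when_def in_keys_iff)
  with update assms(2) show ?case by simp
qed

lemma laurent_eval_mult:
  assumes u: "\<And>i. u i dvd 1"
  shows "laurent_eval u (p * q) = laurent_eval u p * laurent_eval u q"
proof (induction p rule: laurent_induct)
  case (add m c p)
  have "laurent_eval u (Poly_Mapping.single m c * q)
      = laurent_eval u (Poly_Mapping.single m c) * laurent_eval u q"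
  proof (induction q rule: laurent_induct)
    case (add n d q)
    have "laurent_eval u (Poly_Mapping.single m c * Poly_Mapping.single n d)
        = laurent_eval u (Poly_Mapping.single m c) * laurent_eval u (Poly_Mapping.single n d)"
      by (simp add: mult_single laurent_eval_single lookup_add unit_powi_add[OF u] prod.distrib)
    with add show ?case by (simp add: laurent_eval_add algebra_simps)
  qed simp
  with add show ?case by (simp add: laurent_eval_add algebra_simps)
qed simp

lemma laurent_eval_lpow: "laurent_eval u (lpow i n) = unit_powi (u i) n"
proof -
  have "(\<Prod>j\<in>UNIV. unit_powi (u j) (Poly_Mapping.lookup (Poly_Mapping.single i n) j))
      = (\<Prod>j\<in>UNIV. if j = i then unit_powi (u j) n else 1)"
    by (rule prod.cong) (auto simp: lookup_single when_def)
  then show ?thesis by (simp add: lpow_def laurent_eval_single)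
qed

lemma laurent_eval_unique:
  fixes f :: "laurent \<Rightarrow> 'r::comm_ring_1"
  assumes add: "\<And>p q. f (p + q) = f p + f q" and mult: "\<And>p q. f (p * q) = f p * f q"
    and one: "f 1 = 1" and var: "\<And>i. f (lpow i 1) = u i"
  shows "f = laurent_eval u"
proof
  have zero: "f 0 = 0" using add[of 0 0] by simp
  have f_powi: "f (lpow i n) = unit_powi (u i) n" for i n
    using unit_powi_unique[of "\<lambda>n. f (lpow i n)" n] by (simp add: one lpow_add mult var)
  have nat: "f (of_nat k) = of_nat k" for k
    by (induction k) (simp_all add: zero one add)
  have neg: "f (- p) = - f p" for p
    using add[of p "- p"] zero by (simp add: add_eq_0_iff)
  have int: "f (of_int c) = of_int c" for c
    by (cases c rule: int_cases2) (simp_all add: nat neg)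
  have mono: "(Poly_Mapping.single m 1 :: laurent) = (\<Prod>i\<in>UNIV. lpow i (Poly_Mapping.lookup m i))" for m
  proof -
    have "(\<Sum>i\<in>UNIV. Poly_Mapping.single i (Poly_Mapping.lookup m i)) = m"
      by (rule poly_mapping_eqI) (simp add: lookup_sum lookup_single when_def)
    moreover have "(\<Prod>i\<in>I. lpow i (g i)) =
        Poly_Mapping.single (\<Sum>i\<in>I. Poly_Mapping.single i (g i)) 1" if "finite I" for I g
      using that by induction (simp_all add: lpow_def mult_single)
    ultimately show ?thesis by simp
  qed
  have fprod: "f (prod g I) = (\<Prod>i\<in>I. f (g i))" if "finite I" for g and I :: "lvar set"
    using that by induction (simp_all add: one mult)
  have single: "f (Poly_Mapping.single m c) = laurent_eval u (Poly_Mapping.single m c)" for m c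
  proof -
    have "Poly_Mapping.single m c = of_int c * Poly_Mapping.single m 1"
      by (simp flip: single_of_int add: mult_single)
    then have "f (Poly_Mapping.single m c) = of_int c * f (Poly_Mapping.single m 1)"
      by (simp only: mult int)
    then show ?thesis by (simp add: mono fprod f_powi laurent_eval_single)
  qed
  show "f p = laurent_eval u p" for p
    by (induction p rule: laurent_induct) (simp_all add: zero add single laurent_eval_add)
qed

end

theory Submission
  imports Defs
begin

text \<open>
  Write \<open>B\<^sub>p = A\<^sub>p t\<^sub>p\<close>. The existence of \<open>\<delta>\<close> says that \<open>t\<^sub>p + t\<^sub>p\<^sup>-\<^sup>1\<close> is constant, so in a
  domain every \<open>t\<^sub>p\<close> is \<open>s\<close> or \<open>s\<^sup>-\<^sup>1\<close> with \<open>s = t\<^sub>0\<^sub>0\<^sub>0\<close>, and \<open>w\<close> fixes \<open>A\<^sub>a\<^sub>b\<^sub>b\<close> in terms of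
  \<open>t\<^sub>a\<^sub>b\<^sub>b\<close>. Dividing (b)--(e) by (a) leaves equations in the ratios only, and since
  these take just the two values \<open>s, s\<^sup>-\<^sup>1\<close>, the equations collapse to equalities
  \<open>t\<^sub>Q = t\<^sub>Q\<^sub>'\<close>, \<open>t\<^sub>S = t\<^sub>P\<^sub>'\<close>, \<open>t\<^sub>P = t\<^sub>S\<^sub>'\<close> and \<open>t\<^sub>P = t\<^sub>S \<longrightarrow> t\<^sub>Q = t\<^sub>P\<close>. On \<open>X\<^sub>2\<close> exactly five patterns satisfy
  these (they coincide if \<open>s = s\<^sup>-\<^sup>1\<close>); the remaining content of (a) is \<open>A\<^sub>1\<^sub>0\<^sub>1 A\<^sub>1\<^sub>1\<^sub>0 = A\<^sub>0\<^sub>0\<^sub>1 A\<^sub>0\<^sub>1\<^sub>0\<close>.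
\<close>

section \<open>Ratios in an integral domain\<close>

lemma all_bit_iff: "(\<forall>x::bit. P x) \<longleftrightarrow> P 0 \<and> P 1"
  by (metis bit.exhaust)

text \<open>The polynomial X^2 - (s + s') X + 1 has the roots \<open>s\<close> and
  \<open>s'\<close>, and \<open>t\<close> is a root of it too.\<close>

lemma eq_or_eq_inverse:
  fixes s :: "'r::idom"
  assumes "s * s' = 1" "t * t' = 1" "t + t' = s + s'"
  shows "t = s \<or> t = s'"
proof -
  have "(t - s) * (t - s') = 0"
    using assms by algebra
  then show ?thesis by simp
qed

text \<open>The shape of the two long skein equations after division, with \<delta> = -(s + s'). If
  x \<noteq> y, then x y = 1 and the sum collapses to \<open>z\<close>; if x = y, it is x - x^2 (x -
  z), and only q = z = x survives.\<close>

lemma skein_ratio_iff: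
  fixes s :: "'r::idom"
  assumes "s * s' = 1" "{x, y, z, q} \<subseteq> {s, s'}"
  shows "q = y + x - (s + s') * x * y + x * z * y \<longleftrightarrow> q = z \<and> (x = y \<longrightarrow> z = x)"
proof (cases "x = y")
  case True
  \<comment> \<open>\<open>x'\<close> is the partner of \<open>x\<close> in the pair
    \<open>s\<close>, \<open>s'\<close>.\<close>
  obtain x' where x': "x * x' = 1" "x + x' = s + s'" "{z, q} \<subseteq> {x, x'}"
  proof
    show "x * (s + s' - x) = 1" "{z, q} \<subseteq> {x, s + s' - x}"
      using assms by (auto simp: mult.commute)
  qed simp
  have rhs: "y + x - (s + s') * x * y + x * z * y = x - x * x * (x - z)"
    using x'(1) unfolding True x'(2)[symmetric] by algebra
  \<comment> \<open>For z = x', both q = x and q = x' turn out to force x = x'; in the second case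
    multiplication by \<open>x\<close> yields (x^2 - 1)^2 = 0.\<close>
  have "x = x'" if "x * x * (x - x') = 0"
    using that x'(1) by auto
  moreover have "x = x'" if "x' = x - x * x * (x - x')"
  proof -
    have "(x * x - 1) * (x * x - 1) = 0"
      using that x'(1) by algebra
    then have "x * (x - x') = 0"
      using x'(1) by (simp add: right_diff_distrib)
    then show ?thesis
      using x'(1) by auto
  qed
  ultimately have "z = x \<and> q = x" if "q = x - x * x * (x - z)"
    using x'(3) that by auto
  moreover have "q = x - x * x * (x - z)" if "z = x" "q = x"
    using that by simp
  ultimately show ?thesis
    unfolding rhs using True by auto
next
  case False
  then have "x * y = 1" "x + y = s + s'"
    using assms by (auto simp: mult.commute add.commute)
  then have "y + x - (s + s') * x * y + x * z * y = z" by algebra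
  then show ?thesis using False by simp
qed

text \<open>By the first equation, both sides of each other equation are one product
  \<open>m\<close> times a term in the ratios. The last two equations both give q = q', so the
  second and third cancel to r = p' and p = r'; the two implications then coincide.\<close>

lemma tribracket_equations_iff:
  fixes s :: "'r::idom"
  assumes "s * s' = 1" "{p, q, r, p', q', r'} \<subseteq> {s, s'}"
    and "a \<noteq> 0" "b \<noteq> 0" "c \<noteq> 0"
    and B: "B1 = a * p" "B2 = b * q" "B3 = c * r" "B1' = a' * p'" "B2' = b' * q'" "B3' = c' * r'"
  shows
    "a * b * c = a' * b' * c' \<and>
     a * B2 * B3 = B1' * B2' * c' \<and>
     B1 * B2 * c = a' * B2' * B3' \<and>
     a * B2 * c = a' * b' * B3' + B1' * b' * c' + (- s - s') * B1' * b' * B3' + B1' * B2' * B3' \<and>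
     a * b * B3 + B1 * b * c + (- s - s') * B1 * b * B3 + B1 * B2 * B3 = a' * B2' * c' \<longleftrightarrow>
     a * b * c = a' * b' * c' \<and> q = q' \<and> r = p' \<and> p = r' \<and> (p = r \<longrightarrow> q = p)"
proof (cases "a * b * c = a' * b' * c'")
  case True
  define m where "m = a * b * c"
  have m: "a * b * c = m" "a' * b' * c' = m"
    using True by (simp_all add: m_def)
  have "m \<noteq> 0"
    using assms(3-5) by (simp add: m_def)
  have q: "q \<noteq> 0"
    using assms(1,2) by auto
  have eqs1: "a * B2 * B3 = m * (q * r)" "B1 * B2 * c = m * (p * q)" "a * B2 * c = m * q"
      "a * b * B3 + B1 * b * c + (- s - s') * B1 * b * B3 + B1 * B2 * B3 =
        m * (r + p - (s + s') * p * r + p * q * r)"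
    unfolding B m(1)[symmetric] by (simp_all add: algebra_simps)
  have eqs2: "B1' * B2' * c' = m * (p' * q')" "a' * B2' * B3' = m * (q' * r')"
      "a' * B2' * c' = m * q'"
      "a' * b' * B3' + B1' * b' * c' + (- s - s') * B1' * b' * B3' + B1' * B2' * B3' =
        m * (r' + p' - (s + s') * p' * r' + p' * q' * r')"
    unfolding B m(2)[symmetric] by (simp_all add: algebra_simps)
  have skein1: "q = r' + p' - (s + s') * p' * r' + p' * q' * r' \<longleftrightarrow>
      q = q' \<and> (p' = r' \<longrightarrow> q' = p')"
    using assms by (intro skein_ratio_iff) auto
  have skein2: "r + p - (s + s') * p * r + p * q * r = q' \<longleftrightarrow>
      q' = q \<and> (p = r \<longrightarrow> q = p)"
    using assms by (subst eq_commute, intro skein_ratio_iff) auto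
  have "q * r = p' * q' \<longleftrightarrow> r = p'" "p * q = q' * r' \<longleftrightarrow> p = r'" if "q = q'"
    using q that by (simp_all add: mult.commute)
  then show ?thesis
    unfolding eqs1 eqs2 mult_cancel_left skein1 skein2 using \<open>m \<noteq> 0\<close> True by blast
qed simp

section \<open>Tribracket brackets in terms of ratios\<close>

text \<open>\<delta> is a parameter so that the existential quantifier over it can be eliminated
  separately.\<close>

definition skein_equations ::
    "'r::comm_ring_1 \<Rightarrow> (bit \<times> bit \<times> bit \<Rightarrow> 'r) \<Rightarrow> (bit \<times> bit \<times> bit \<Rightarrow> 'r) \<Rightarrow> bool"
  where "skein_equations \<delta> A B \<longleftrightarrow>
    (\<forall>a b c d.
        let P = (a, b, c); Q = (c, tb a b c, tb a c d); S = (a, c, d);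
            P' = (b, tb a b c, tb a b d); Q' = (a, b, d); S' = (d, tb a b d, tb a c d)
        in
          A P * A Q * A S = A P' * A Q' * A S' \<and>
          A P * B Q * B S = B P' * B Q' * A S' \<and>
          B P * B Q * A S = A P' * B Q' * B S' \<and>
          A P * B Q * A S =
            A P' * A Q' * B S' + B P' * A Q' * A S' + \<delta> * B P' * A Q' * B S' + B P' * B Q' * B S' \<and>
          A P * A Q * B S + B P * A Q * A S + \<delta> * B P * A Q * B S + B P * B Q * B S =
            A P' * B Q' * A S')"

text \<open>
  The \<open>i\<close>-th family in terms of \<open>A\<close> and the ratios \<open>t = B / A\<close>. Here \<open>s'\<close> stands for \<open>s\<^sup>-\<^sup>1\<close>, so that
  \<open>x\<^sub>1\<^sup>3 x\<^sub>5\<^sup>-\<^sup>2\<close> reads \<open>A\<^sub>0\<^sub>0\<^sub>0 s'\<^sup>2\<close>.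
\<close>

definition normal_form ::
    "nat \<Rightarrow> (bit \<times> bit \<times> bit \<Rightarrow> 'r::comm_ring_1) \<Rightarrow> (bit \<times> bit \<times> bit \<Rightarrow> 'r) \<Rightarrow> 'r \<Rightarrow> 'r \<Rightarrow> bool"
  where "normal_form i A t s s' \<longleftrightarrow>
    A (1, 1, 1) = A (0, 0, 0) \<and>
    A (1, 0, 1) * A (1, 1, 0) = A (0, 0, 1) * A (0, 1, 0) \<and>
    (\<forall>p\<in>{(0, 1, 1), (1, 0, 0)}. A p = (if i \<in> {1, 3, 5} then A (0, 0, 0) else A (0, 0, 0) * s'\<^sup>2)) \<and>
    (\<forall>p\<in>{(0, 0, 0), (1, 1, 1)}. t p = s) \<and>
    (\<forall>p\<in>{(0, 1, 1), (1, 0, 0)}. t p = (if i \<in> {1, 3, 5} then s else s')) \<and>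
    (\<forall>p\<in>{(0, 0, 1), (1, 1, 0)}. t p = (if i \<in> {1, 2, 5} then s else s')) \<and>
    (\<forall>p\<in>{(0, 1, 0), (1, 0, 1)}. t p = (if i \<in> {1, 2} then s' else s))"

text \<open>The instances at (0, 0, 0) force \<delta> = -s - s' and w = -A(0, 0, 0) s'. Constancy of
  \<delta> then puts every ratio in {s, s'}, as \<open>tribracket_equations_iff\<close>
  requires.\<close>

lemma tribracket_bracket_ratio_iff:
  fixes A B t :: "bit \<times> bit \<times> bit \<Rightarrow> 'r::idom"
  assumes A: "\<And>p. A p * A' p = 1" and t: "\<And>p. t p * t' p = 1" and B: "\<And>p. B p = A p * t p"
  defines "s \<equiv> t (0, 0, 0)" and "s' \<equiv> t' (0, 0, 0)"
  shows "tribracket_bracket A B \<longleftrightarrow>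
    (\<forall>p. t p \<in> {s, s'}) \<and> (\<forall>a b. A (a, b, b) = A (0, 0, 0) * s' * t (a, b, b)) \<and>
    (\<forall>a b c d.
      A (a, b, c) * A (c, tb a b c, tb a c d) * A (a, c, d) =
        A (b, tb a b c, tb a b d) * A (a, b, d) * A (d, tb a b d, tb a c d) \<and>
      t (c, tb a b c, tb a c d) = t (a, b, d) \<and>
      t (a, c, d) = t (b, tb a b c, tb a b d) \<and>
      t (a, b, c) = t (d, tb a b d, tb a c d) \<and>
      (t (a, b, c) = t (a, c, d) \<longrightarrow> t (c, tb a b c, tb a c d) = t (a, b, c)))"
    (is "_ \<longleftrightarrow> ?ratio \<and> ?w \<and> (\<forall>a b c d. ?eqs a b c d)")
proof -
  have ss: "s * s' = 1"
    using t by (simp add: s_def s'_def)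
  have BB': "B p * (A' p * t' p) = 1" for p
  proof -
    have "B p * (A' p * t' p) = (A p * A' p) * (t p * t' p)"
      by (simp add: B mult_ac)
    then show ?thesis by (simp add: A t)
  qed
  have A_nonzero: "A p \<noteq> 0" for p
    using A[of p] by auto
  have units: "A p dvd 1 \<and> B p dvd 1" for p
    using A[of p] BB'[of p] by (metis dvd_triv_left)
  have inv: "unit_inv (A p) = A' p" "unit_inv (B p) = A' p * t' p" for p
    by (rule unit_inv_eqI, rule A BB')+
  have \<delta>: "- A p * unit_inv (B p) - unit_inv (A p) * B p = - t p - t' p" for p
    using A[of p] unfolding inv unfolding B by algebra
  have w: "- ((A p)\<^sup>2 * unit_inv (B p)) = - (A p * t' p)" for p
    using A[of p] unfolding inv by algebra
  have \<delta>_iff: "(\<forall>a b c. - s - s' = - t (a, b, c) - t' (a, b, c)) \<longleftrightarrow> ?ratio"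
  proof -
    have "- s - s' = - t p - t' p \<longleftrightarrow> t p \<in> {s, s'}" for p
    proof
      assume "- s - s' = - t p - t' p"
      then have "t p + t' p = s + s'" by algebra
      then show "t p \<in> {s, s'}"
        using eq_or_eq_inverse[OF ss t] by simp
    next
      assume "t p \<in> {s, s'}"
      then show "- s - s' = - t p - t' p"
        using ss t[of p] by (auto, algebra+)
    qed
    then show ?thesis by (simp add: split_paired_all)
  qed
  have w_iff: "- (A (0, 0, 0) * s') = - (A p * t' p) \<longleftrightarrow> A p = A (0, 0, 0) * s' * t p" for p
    using t[of p] by algebra
  have "tribracket_bracket A B \<longleftrightarrow>
      (\<exists>\<delta> w. (\<forall>a b c. \<delta> = - t (a, b, c) - t' (a, b, c)) \<and>
        (\<forall>a b. w = - (A (a, b, b) * t' (a, b, b))) \<and> skein_equations \<delta> A B)"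
    unfolding tribracket_bracket_def skein_equations_def \<delta> w using units by blast
  also have "\<dots> \<longleftrightarrow> (\<forall>a b c. - s - s' = - t (a, b, c) - t' (a, b, c)) \<and>
      (\<forall>a b. - (A (0, 0, 0) * s') = - (A (a, b, b) * t' (a, b, b))) \<and> skein_equations (- s - s') A B"
    unfolding s_def s'_def by metis
  also have "\<dots> \<longleftrightarrow> ?ratio \<and> ?w \<and> skein_equations (- s - s') A B"
    unfolding \<delta>_iff w_iff ..
  also have "\<dots> \<longleftrightarrow> ?ratio \<and> ?w \<and> (\<forall>a b c d. ?eqs a b c d)"
  proof -
    have "skein_equations (- s - s') A B \<longleftrightarrow> (\<forall>a b c d. ?eqs a b c d)" if "?ratio"
      unfolding skein_equations_def Let_def
      by (intro arg_cong[where f = All] ext tribracket_equations_iff[OF ss _ _ _ _ B B B B B B])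
        (use that A_nonzero in auto)
    then show ?thesis by blast
  qed
  finally show ?thesis .
qed

section \<open>The five ratio patterns\<close>

lemma normal_form_iff:
  fixes A t :: "bit \<times> bit \<times> bit \<Rightarrow> 'r::idom"
  assumes nonzero: "\<And>p. A p \<noteq> 0" and ss: "s * s' = 1" and s: "s = t (0, 0, 0)"
  shows "(\<forall>p. t p \<in> {s, s'}) \<and> (\<forall>a b. A (a, b, b) = A (0, 0, 0) * s' * t (a, b, b)) \<and>
    (\<forall>a b c d.
      A (a, b, c) * A (c, tb a b c, tb a c d) * A (a, c, d) =
        A (b, tb a b c, tb a b d) * A (a, b, d) * A (d, tb a b d, tb a c d) \<and>
      t (c, tb a b c, tb a c d) = t (a, b, d) \<and>
      t (a, c, d) = t (b, tb a b c, tb a b d) \<and>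
      t (a, b, c) = t (d, tb a b d, tb a c d) \<and>
      (t (a, b, c) = t (a, c, d) \<longrightarrow> t (c, tb a b c, tb a c d) = t (a, b, c))) \<longleftrightarrow>
    (\<exists>i\<in>{1, 2, 3, 4, 5}. normal_form i A t s s')"
    (is "?ratio \<and> ?w \<and> (\<forall>a b c d. ?eqs a b c d) \<longleftrightarrow> _")
proof
  assume "?ratio \<and> ?w \<and> (\<forall>a b c d. ?eqs a b c d)"
  then have r: ?ratio and w: ?w
    and eqA: "A (a, b, c) * A (c, tb a b c, tb a c d) * A (a, c, d) =
        A (b, tb a b c, tb a b d) * A (a, b, d) * A (d, tb a b d, tb a c d)"
    and eqQ: "t (c, tb a b c, tb a c d) = t (a, b, d)"
    and eqS: "t (a, c, d) = t (b, tb a b c, tb a b d)"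
    and eqP: "t (a, b, c) = t (d, tb a b d, tb a c d)"
    and eqT: "t (a, b, c) = t (a, c, d) \<Longrightarrow> t (c, tb a b c, tb a c d) = t (a, b, c)" for a b c d
    by blast+
  \<comment> \<open>This leaves three free ratios, hence at most eight patterns.\<close>
  have t: "t (1, 1, 1) = s" "t (1, 0, 0) = t (0, 1, 1)" "t (1, 1, 0) = t (0, 0, 1)"
    "t (1, 0, 1) = t (0, 1, 0)"
    using eqP[of 0 0 0 1] eqP[of 0 1 1 1] eqP[of 0 0 1 1] eqQ[of 1 0 1 0] s
    by (simp_all add: tb_def)
  have "t (0, 1, 1) \<in> {s, s'}" "t (0, 0, 1) \<in> {s, s'}" "t (0, 1, 0) \<in> {s, s'}"
    using r by blast+
  \<comment> \<open>This excludes three of the eight patterns; the others are listed below in the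
    order of the families.\<close>
  moreover have "t (0, 0, 1) = t (0, 1, 0) \<Longrightarrow> t (0, 0, 1) = s \<and> t (0, 1, 1) = s"
    using eqT[of 0 0 1 0] eqT[of 0 1 0 1] t(1) by (simp add: tb_def)
  ultimately have sol:
    "t (0, 1, 1) = s \<and> t (0, 0, 1) = s \<and> t (0, 1, 0) = s' \<or>
     t (0, 1, 1) = s' \<and> t (0, 0, 1) = s \<and> t (0, 1, 0) = s' \<or>
     t (0, 1, 1) = s \<and> t (0, 0, 1) = s' \<and> t (0, 1, 0) = s \<or>
     t (0, 1, 1) = s' \<and> t (0, 0, 1) = s' \<and> t (0, 1, 0) = s \<or>
     t (0, 1, 1) = s \<and> t (0, 0, 1) = s \<and> t (0, 1, 0) = s"
    by auto
  have "A (0, 0, 0) * A (0, 0, 1) * A (0, 0, 1) = A (0, 0, 1) * A (0, 0, 1) * A (1, 1, 1)"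
    "A (0, 1, 0) * A (0, 1, 1) * A (0, 0, 1) = A (1, 1, 0) * A (0, 1, 1) * A (1, 0, 1)"
    using eqA[of 0 0 0 1] eqA[of 0 1 0 1] by (simp_all add: tb_def)
  then have A: "A (1, 1, 1) = A (0, 0, 0)"
      "A (1, 0, 1) * A (1, 1, 0) = A (0, 0, 1) * A (0, 1, 0)"
    using nonzero by (auto simp: mult_ac)
  have nf: "normal_form i A t s s'"
    if i: "t (0, 1, 1) = (if i \<in> {1, 3, 5} then s else s')"
      "t (0, 0, 1) = (if i \<in> {1, 2, 5} then s else s')"
      "t (0, 1, 0) = (if i \<in> {1, 2} then s' else s)" for i
  proof -
    \<comment> \<open>The value A(0, 0, 0) s' t prescribed by \<open>w\<close> is A(0, 0, 0) for t =
      s and A(0, 0, 0) s'^2 for t = s'.\<close>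
    have "A p = (if i \<in> {1, 3, 5} then A (0, 0, 0) else A (0, 0, 0) * s'\<^sup>2)"
      if p: "p \<in> {(0, 1, 1), (1, 0, 0)}" for p
    proof -
      have "t p = (if i \<in> {1, 3, 5} then s else s')"
        using p t i(1) by auto
      moreover have "A p = A (0, 0, 0) * s' * t p"
        using w p by blast
      ultimately show ?thesis
        using ss by (simp add: power2_eq_square mult.assoc mult.commute[of s' s])
    qed
    then show ?thesis
      unfolding normal_form_def using t A s i by simp
  qed
  from sol show "\<exists>i\<in>{1, 2, 3, 4, 5}. normal_form i A t s s'"
    using nf[of 1] nf[of 2] nf[of 3] nf[of 4] nf[of 5] by (elim disjE) simp_all
next
  assume "\<exists>i\<in>{1, 2, 3, 4, 5}. normal_form i A t s s'"
  then obtain i :: nat where i: "i \<in> {1, 2, 3, 4, 5}" and nf: "normal_form i A t s s'"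
    by blast
  let ?g = "if i \<in> {1, 3, 5} then s else s'"
  have t: "t (1, 1, 1) = s" "t (0, 1, 1) = ?g" "t (1, 0, 0) = ?g"
    "t (0, 0, 1) = (if i \<in> {1, 2, 5} then s else s')"
    "t (1, 1, 0) = (if i \<in> {1, 2, 5} then s else s')"
    "t (0, 1, 0) = (if i \<in> {1, 2} then s' else s)"
    "t (1, 0, 1) = (if i \<in> {1, 2} then s' else s)"
    using nf by (simp_all add: normal_form_def)
  have A: "A (1, 1, 1) = A (0, 0, 0)" "A (1, 0, 0) = A (0, 1, 1)"
    and rel: "A (1, 0, 1) * A (1, 1, 0) = A (0, 0, 1) * A (0, 1, 0)"
    and g: "A (0, 1, 1) = A (0, 0, 0) * s' * ?g"
    using nf ss by (simp_all add: normal_form_def power2_eq_square mult_ac)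
  have "A (a, b, c) * A (c, tb a b c, tb a c d) * A (a, c, d) =
      A (b, tb a b c, tb a b d) * A (a, b, d) * A (d, tb a b d, tb a c d)" for a b c d
    by (cases a; cases b; cases c; cases d) (use rel in \<open>auto simp: tb_def A mult_ac\<close>)
  moreover have "?ratio"
    unfolding all_bit_iff split_paired_All using t s by auto
  moreover have "?w"
    unfolding all_bit_iff using A g t s ss by (simp add: mult_ac)
  moreover have "t (c, tb a b c, tb a c d) = t (a, b, d) \<and>
      t (a, c, d) = t (b, tb a b c, tb a b d) \<and>
      t (a, b, c) = t (d, tb a b d, tb a c d) \<and>
      (t (a, b, c) = t (a, c, d) \<longrightarrow> t (c, tb a b c, tb a c d) = t (a, b, c))" for a b c d
    using i by (cases a; cases b; cases c; cases d) (auto simp: tb_def t s[symmetric])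
  ultimately show "?ratio \<and> ?w \<and> (\<forall>a b c d. ?eqs a b c d)"
    by blast
qed

section \<open>Specialization of the Laurent families\<close>

text \<open>Since B(0, 0, 0) = A(0, 0, 0) s, the monomial x_1^-1 x_5 specializes to \<open>s\<close>
  and x_1 x_5^-1 to \<open>s'\<close>, so a family prescribes a pattern of ratios.\<close>

lemma laurent_families_iff:
  fixes A B t :: "bit \<times> bit \<times> bit \<Rightarrow> 'r::idom"
  assumes A: "\<And>p. A p * A' p = 1" and t: "\<And>p. t p * t' p = 1" and B: "\<And>p. B p = A p * t p"
  shows "(laurent_hom A B \<circ> A_fam i, laurent_hom A B \<circ> B_fam i) = (A, B) \<longleftrightarrow>
    normal_form i A t (t (0, 0, 0)) (t' (0, 0, 0))"
proof -
  define x x' s s' where "x = A (0, 0, 0)" and "x' = A' (0, 0, 0)"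
    and "s = t (0, 0, 0)" and "s' = t' (0, 0, 0)"
  have x: "x * x' = 1" and ss: "s * s' = 1"
    using A t by (simp_all add: x_def x'_def s_def s'_def)
  then have xs: "x * s * (x' * s') = 1"
    by algebra
  have nonzero: "A p \<noteq> 0" for p
    using A[of p] by auto
  have u: "(case j of X1 \<Rightarrow> A (0, 0, 0) | X2 \<Rightarrow> A (0, 0, 1) | X3 \<Rightarrow> A (0, 1, 0) | X4 \<Rightarrow> A (1, 0, 1)
      | X5 \<Rightarrow> B (0, 0, 0)) dvd 1" for j
  proof -
    have "A p dvd 1" for p
      using A[of p] by (metis dvd_triv_left)
    moreover have "B (0, 0, 0) dvd 1"
      using xs unfolding B x_def s_def by (metis dvd_triv_left)
    ultimately show ?thesis by (simp split: lvar.split)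
  qed
  let ?f = "laurent_hom A B"
  have mult: "?f (p * q) = ?f p * ?f q" for p q
    unfolding laurent_hom_def by (rule laurent_eval_mult) (rule u)
  have powi: "unit_powi v 3 = v ^ 3" "unit_powi v 4 = v ^ 4" "unit_powi v (- 1) = unit_inv v"
    "unit_powi v (- 2) = unit_inv v ^ 2" "unit_powi v (- 3) = unit_inv v ^ 3" for v :: 'r
    by (simp_all add: unit_powi_def)
  have "?f (lpow X1 n) = unit_powi x n" "?f (lpow X2 n) = unit_powi (A (0, 0, 1)) n"
    "?f (lpow X3 n) = unit_powi (A (0, 1, 0)) n" "?f (lpow X4 n) = unit_powi (A (1, 0, 1)) n"
    "?f (lpow X5 n) = unit_powi (x * s) n" for n
    by (simp_all add: laurent_hom_def laurent_eval_lpow x_def s_def B)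
  note eval = mult this powi unit_powi_1 unit_inv_eqI[OF x] unit_inv_eqI[OF xs] unit_inv_eqI[OF A]
  have monomials: "x ^ 3 * (x' * s')\<^sup>2 = x * s'\<^sup>2" "x ^ 4 * (x' * s') ^ 3 = x * s'\<^sup>2 * s'"
    "x' * a * (x * s) = a * s" "x * a * (x' * s') = a * s'"
    "x' * a * b * c * (x * s) = a * b * c * s" "x * a * b * c * (x' * s') = a * b * c * s'" for a b c
    using x by algebra+
  have fA: "?f (A_fam i (0, 0, 0)) = x" "?f (A_fam i (1, 1, 1)) = x"
    "?f (A_fam i (0, 0, 1)) = A (0, 0, 1)" "?f (A_fam i (0, 1, 0)) = A (0, 1, 0)"
    "?f (A_fam i (1, 0, 1)) = A (1, 0, 1)"
    "?f (A_fam i (1, 1, 0)) = A (0, 0, 1) * A (0, 1, 0) * A' (1, 0, 1)"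
    "?f (A_fam i (0, 1, 1)) = (if i \<in> {1, 3, 5} then x else x * s'\<^sup>2)"
    "?f (A_fam i (1, 0, 0)) = (if i \<in> {1, 3, 5} then x else x * s'\<^sup>2)"
    by (simp_all add: A_fam_def eval monomials)
  \<comment> \<open>The ratio of the specialized \<open>B_fam\<close> to the specialized
    \<open>A_fam\<close>.\<close>
  define r where "r p =
    (if p \<in> {(0, 0, 0), (1, 1, 1)} then s
     else if p \<in> {(0, 1, 1), (1, 0, 0)} then if i \<in> {1, 3, 5} then s else s'
     else if p \<in> {(0, 0, 1), (1, 1, 0)} then if i \<in> {1, 2, 5} then s else s'
     else if i \<in> {1, 2} then s' else s)" for p :: "bit \<times> bit \<times> bit"
  have fB: "?f (B_fam i p) = ?f (A_fam i p) * r p" for p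
  proof -
    have "\<forall>a b c. ?f (B_fam i (a, b, c)) = ?f (A_fam i (a, b, c)) * r (a, b, c)"
      unfolding all_bit_iff fA by (auto simp: B_fam_def r_def eval monomials)
    then show ?thesis by (cases p) auto
  qed
  \<comment> \<open>The entry x_2 x_3 x_4^-1 at (1, 1, 0) is the relation of
    \<open>normal_form\<close> solved for A(1, 1, 0).\<close>
  have "A (0, 0, 1) * A (0, 1, 0) * A' (1, 0, 1) = A (1, 1, 0) \<longleftrightarrow>
      A (1, 0, 1) * A (1, 1, 0) = A (0, 0, 1) * A (0, 1, 0)"
    using A[of "(1, 0, 1)"] by algebra
  then have "(\<forall>a b c. ?f (A_fam i (a, b, c)) = A (a, b, c) \<and> t (a, b, c) = r (a, b, c)) \<longleftrightarrow>
      normal_form i A t s s'"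
    unfolding all_bit_iff fA normal_form_def r_def by (auto simp: x_def s_def)
  moreover have "(?f \<circ> A_fam i, ?f \<circ> B_fam i) = (A, B) \<longleftrightarrow>
      (\<forall>p. ?f (A_fam i p) = A p \<and> t p = r p)"
    using nonzero by (auto simp: fun_eq_iff fB B)
  ultimately show ?thesis
    unfolding s_def s'_def by (simp add: split_paired_All)
qed

theorem theorem4p5:
  fixes A B :: "bit \<times> bit \<times> bit \<Rightarrow> 'r::idom"
  assumes "\<And>p. A p dvd 1" and "\<And>p. B p dvd 1"
  shows "tribracket_bracket A B \<longleftrightarrow>
    (\<exists>i\<in>{1, 2, 3, 4, 5}. (laurent_hom A B \<circ> A_fam i, laurent_hom A B \<circ> B_fam i) = (A, B))"
proof -
  define A' t t' where "A' p = unit_inv (A p)" and "t p = B p * unit_inv (A p)"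
    and "t' p = A p * unit_inv (B p)" for p
  have A: "A p * A' p = 1" for p
    using assms(1) by (simp add: A'_def unit_inv_right)
  have t: "t p * t' p = 1" for p
    using unit_inv_right[OF assms(1)[of p]] unit_inv_right[OF assms(2)[of p]]
    unfolding t_def t'_def by algebra
  have B: "B p = A p * t p" for p
    using unit_inv_right[OF assms(1)[of p]] unfolding t_def by algebra
  have "A p \<noteq> 0" for p
    using A[of p] by auto
  then show ?thesis
    unfolding tribracket_bracket_ratio_iff[OF A t B] laurent_families_iff[OF A t B]
    using t by (intro normal_form_iff) simp_all
qed

end
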